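(* Let $(X,\mathcal{A},\mu)$ be a measure space with $\mu(X)>0$ such that $X$ is not an atom. Let $V\subseteq\mathscr{D}$ be a set of distinct class representatives for the equivalence relation $\sim$ on $\mathscr{D}$, all of whose elements are characteristic functions. Let $G$ be the subgraph of the zero-divisor graph $\Gamma(\mathcal{M}(X,\mathcal{A}))$ induced by $V$, and let $G_2$ be the subgraph of the comaximal graph $\Gamma'_2(\mathcal{M}(X,\mathcal{A}))$ induced by $V$. Then $G$ and $G_2$ are isomorphic as graphs.
   Context: $\mathcal{M}(X,\mathcal{A})$ is the commutative ring (pointwise operations) of all $\mathcal{A}$-measurable functions $f:X\to\mathbb{R}$; $Z(f)=\{x\in X:f(x)=0\}$; $1_A$ is the characteristic function of $A$. A set $A\in\mathcal{A}$ is an atom if $\mu(A)>0$ and $A$ cannot be written as a disjoint union $A=B\sqcup C$ with $B,C\in\mathcal{A}$, $\mu(B)>0$, $\mu(C)>0$. A function $u$ is a $\mu$-unit if $\mu(Z(u))=0$. Write $\mathscr{D}=\{f\in\mathcal{M}(X,\mathcal{A}):\mu(Z(f))>0\text{ and }\mu(X\setminus Z(f))>0\}$. The zero-divisor graph $\Gamma(\mathcal{M}(X,\mathcal{A}))$ is the simple graph with vertex set $\mathscr{D}$ in which distinct $f,g$ are adjacent iff $\mu((X\setminus Z(f))\cap(X\setminus Z(g)))=0$. The comaximal graph $\Gamma'_2(\mathcal{M}(X,\mathcal{A}))$ is the simple graph with vertex set $\mathscr{D}$ in which distinct $f,g$ are adjacent iff $\langle f\rangle+\langle g\rangle=\langle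 u\rangle$ (sum of principal ideals) for some $\mu$-unit $u$. The relation $\sim$ on $\mathscr{D}$ is: $f\sim g$ iff $\mu(Z(f)\triangle Z(g))=0$. The set $V$ contains exactly one element of each $\sim$-class, and each element has the form $1_A$ with $A\in\mathcal{A}$, $\mu(A)>0$, $\mu(X\setminus A)>0$ (so distinct $1_A,1_B\in V$ satisfy $\mu(A\triangle B)>0$). A graph isomorphism is a bijection of vertex sets preserving adjacency in both directions. *)

theory Defs
  imports
    "HOL-Analysis.Analysis"
    "HOL-Algebra.Ideal"
    "Graph_Theory.Digraph_Isomorphism"
    "Graph_Theory.Pair_Digraph"
begin

section \<open>The ring of real-valued measurable functions\<close>

text \<open>
  A function on the underlying set \<^term>\<open>space M\<close> is represented by its extensional extension
  to the whole type, so that equality of ring elements is equality of functions on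
  \<^term>\<open>space M\<close>.
\<close>

definition meas_ring :: "'a measure \<Rightarrow> ('a \<Rightarrow> real) ring" where
  "meas_ring M = \<lparr>
     carrier = borel_measurable M \<inter> extensional (space M),
     mult = (\<lambda>f g. \<lambda>x\<in>space M. f x * g x),
     one = (\<lambda>x\<in>space M. 1),
     zero = (\<lambda>x\<in>space M. 0),
     add = (\<lambda>f g. \<lambda>x\<in>space M. f x + g x)\<rparr>"

definition zero_set :: "'a measure \<Rightarrow> ('a \<Rightarrow> real) \<Rightarrow> 'a set" where
  "zero_set M f = {x \<in> space M. f x = 0}"

definition char_fun :: "'a measure \<Rightarrow> 'a set \<Rightarrow> 'a \<Rightarrow> real" where
  "char_fun M A = (\<lambda>x\<in>space M. indicator A x)"

definition mu_unit :: "'a measure \<Rightarrow> ('a \<Rightarrow> real) \<Rightarrow> bool" where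
  "mu_unit M u \<longleftrightarrow> u \<in> carrier (meas_ring M) \<and> emeasure M (zero_set M u) = 0"

definition atom :: "'a measure \<Rightarrow> 'a set \<Rightarrow> bool" where
  "atom M A \<longleftrightarrow> A \<in> sets M \<and> emeasure M A > 0 \<and>
     \<not> (\<exists>B\<in>sets M. \<exists>C\<in>sets M. A = B \<union> C \<and> B \<inter> C = {} \<and> emeasure M B > 0 \<and> emeasure M C > 0)"


section \<open>The two graphs\<close>

definition mu_divisors :: "'a measure \<Rightarrow> ('a \<Rightarrow> real) set" where
  "mu_divisors M = {f \<in> carrier (meas_ring M).
     emeasure M (zero_set M f) > 0 \<and> emeasure M (space M - zero_set M f) > 0}"

text \<open>Simple graphs are encoded as symmetric, loop-free sets of ordered pairs.\<close>

definition zero_divisor_graph :: "'a measure \<Rightarrow> ('a \<Rightarrow> real) pair_pre_digraph" where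
  "zero_divisor_graph M = \<lparr>
     pverts = mu_divisors M,
     parcs = {(f, g). f \<in> mu_divisors M \<and> g \<in> mu_divisors M \<and> f \<noteq> g \<and>
       emeasure M ((space M - zero_set M f) \<inter> (space M - zero_set M g)) = 0}\<rparr>"

definition comaximal_graph :: "'a measure \<Rightarrow> ('a \<Rightarrow> real) pair_pre_digraph" where
  "comaximal_graph M = \<lparr>
     pverts = mu_divisors M,
     parcs = {(f, g). f \<in> mu_divisors M \<and> g \<in> mu_divisors M \<and> f \<noteq> g \<and>
       (\<exists>u. mu_unit M u \<and>
         (PIdl\<^bsub>meas_ring M\<^esub> f) <+>\<^bsub>meas_ring M\<^esub> (PIdl\<^bsub>meas_ring M\<^esub> g) = PIdl\<^bsub>meas_ring M\<^esub> u)}\<rparr>"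


section \<open>Class representatives\<close>

definition zero_set_rel :: "'a measure \<Rightarrow> ('a \<Rightarrow> real) rel" where
  "zero_set_rel M = {(f, g). f \<in> mu_divisors M \<and> g \<in> mu_divisors M \<and>
     emeasure M (sym_diff (zero_set M f) (zero_set M g)) = 0}"

definition class_representatives :: "'b set \<Rightarrow> 'b rel \<Rightarrow> 'b set \<Rightarrow> bool" where
  "class_representatives D r V \<longleftrightarrow> V \<subseteq> D \<and> (\<forall>C \<in> D // r. \<exists>!v. v \<in> V \<inter> C)"


section \<open>Well-definedness\<close>

lemma borel_measurable_restrict_space:
  "restrict f (space M) \<in> borel_measurable M \<longleftrightarrow> f \<in> borel_measurable M"
  by (rule measurable_cong) simp

lemma cring_meas_ring: "cring (meas_ring M)"
proof (rule cringI)
  show "abelian_group (meas_ring M)"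
  proof (rule abelian_groupI)
    fix f assume f: "f \<in> carrier (meas_ring M)"
    show "\<exists>g\<in>carrier (meas_ring M). g \<oplus>\<^bsub>meas_ring M\<^esub> f = \<zero>\<^bsub>meas_ring M\<^esub>"
      by (rule bexI[where x = "\<lambda>x\<in>space M. - f x"]) (use f in \<open>auto simp: meas_ring_def borel_measurable_restrict_space\<close>)
  qed (auto simp: meas_ring_def borel_measurable_restrict_space extensional_def fun_eq_iff algebra_simps)
  show "comm_monoid (meas_ring M)"
    by (rule comm_monoidI) (auto simp: meas_ring_def borel_measurable_restrict_space extensional_def fun_eq_iff algebra_simps)
qed (auto simp: meas_ring_def fun_eq_iff algebra_simps)

lemma zero_set_sets [measurable]:
  assumes "f \<in> carrier (meas_ring M)"
  shows "zero_set M f \<in> sets M"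
proof -
  have [measurable]: "f \<in> borel_measurable M"
    using assms by (simp add: meas_ring_def)
  show ?thesis unfolding zero_set_def by measurable
qed

lemma equiv_zero_set_rel: "equiv (mu_divisors M) (zero_set_rel M)"
proof (rule equivI)
  show "trans (zero_set_rel M)"
  proof (rule transI)
    fix f g h assume fg: "(f, g) \<in> zero_set_rel M" and gh: "(g, h) \<in> zero_set_rel M"
    have s: "zero_set M f \<in> sets M" "zero_set M g \<in> sets M" "zero_set M h \<in> sets M"
      using fg gh by (auto simp: zero_set_rel_def mu_divisors_def intro: zero_set_sets)
    have "sym_diff (zero_set M f) (zero_set M g) \<union> sym_diff (zero_set M g) (zero_set M h) \<in> null_sets M"
      using fg gh s by (intro null_sets.Un null_setsI) (simp_all add: zero_set_rel_def sets.Un sets.Diff)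
    then have "sym_diff (zero_set M f) (zero_set M h) \<in> null_sets M"
      by (rule null_sets_subset) (use s in auto)
    then show "(f, h) \<in> zero_set_rel M"
      using fg gh by (auto simp: zero_set_rel_def)
  qed
qed (auto simp: zero_set_rel_def refl_on_def sym_def Un_commute)

lemma simple_zero_divisor_graph:
  "loopfree_digraph (with_proj (zero_divisor_graph M))" "sym_digraph (with_proj (zero_divisor_graph M))"
  by (unfold_locales; auto simp: zero_divisor_graph_def symmetric_def sym_def Int_commute)+

lemma simple_comaximal_graph:
  "loopfree_digraph (with_proj (comaximal_graph M))" "sym_digraph (with_proj (comaximal_graph M))"
proof -
  interpret cring "meas_ring M" by (rule cring_meas_ring)
  have comm: "(PIdl\<^bsub>meas_ring M\<^esub> f) <+>\<^bsub>meas_ring M\<^esub> (PIdl\<^bsub>meas_ring M\<^esub> g) =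
      (PIdl\<^bsub>meas_ring M\<^esub> g) <+>\<^bsub>meas_ring M\<^esub> (PIdl\<^bsub>meas_ring M\<^esub> f)"
    if "f \<in> mu_divisors M" "g \<in> mu_divisors M" for f g
  proof (rule set_add_comm)
    show "PIdl\<^bsub>meas_ring M\<^esub> f \<subseteq> carrier (meas_ring M)" "PIdl\<^bsub>meas_ring M\<^esub> g \<subseteq> carrier (meas_ring M)"
      using that by (auto simp: cgenideal_def mu_divisors_def)
  qed
  show "loopfree_digraph (with_proj (comaximal_graph M))" "sym_digraph (with_proj (comaximal_graph M))"
    by (unfold_locales; auto simp: comaximal_graph_def symmetric_def sym_def comm)+
qed

text \<open>
  On graphs given by sets of pairs, \<^const>\<open>digraph_iso\<close> amounts to a bijection of the vertex
  sets that preserves adjacency in both directions.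
\<close>

lemma digraph_iso_induced_iff:
  assumes G: "wf_digraph (with_proj G)"
  shows "digraph_iso (with_proj G \<restriction> V) (with_proj H \<restriction> W) \<longleftrightarrow>
    (\<exists>\<phi>. bij_betw \<phi> V W \<and> (\<forall>u\<in>V. \<forall>v\<in>V. (u, v) \<in> parcs G \<longleftrightarrow> (\<phi> u, \<phi> v) \<in> parcs H))"
    (is "?L \<longleftrightarrow> ?R")
proof
  assume ?L
  then obtain i where i: "pre_digraph.digraph_isomorphism (with_proj G \<restriction> V) i"
    and eq: "with_proj H \<restriction> W = app_iso i (with_proj G \<restriction> V)"
    by (auto simp: digraph_iso_def)
  let ?p = "iso_verts i"
  have W: "?p ` V = W" and tl: "iso_tail i = fst" and hd: "iso_head i = snd"
    using arg_cong[OF eq, of verts] arg_cong[OF eq, of tail] arg_cong[OF eq, of head] by auto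
  have A: "iso_arcs i ` {e \<in> parcs G. fst e \<in> V \<and> snd e \<in> V} =
      {e \<in> parcs H. fst e \<in> W \<and> snd e \<in> W}"
    using arg_cong[OF eq, of arcs] by simp
  have ar: "iso_arcs i e = (?p (fst e), ?p (snd e))"
      if "e \<in> parcs G" "fst e \<in> V" "snd e \<in> V" for e
    using i that unfolding pre_digraph.digraph_isomorphism_def tl hd
    by (cases e) (auto simp: prod_eq_iff)
  have inj: "inj_on ?p V"
    using i by (auto simp: pre_digraph.digraph_isomorphism_def)
  have "(u, v) \<in> parcs G \<longleftrightarrow> (?p u, ?p v) \<in> parcs H" if uv: "u \<in> V" "v \<in> V" for u v
  proof
    assume "(u, v) \<in> parcs G"
    then have "iso_arcs i (u, v) \<in> {e \<in> parcs H. fst e \<in> W \<and> snd e \<in> W}"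
      using uv A by (metis (mono_tags, lifting) fst_conv imageI mem_Collect_eq snd_conv)
    then show "(?p u, ?p v) \<in> parcs H"
      using ar[OF \<open>(u, v) \<in> parcs G\<close>] uv by simp
  next
    assume "(?p u, ?p v) \<in> parcs H"
    then have "(?p u, ?p v) \<in> iso_arcs i ` {e \<in> parcs G. fst e \<in> V \<and> snd e \<in> V}"
      unfolding A using uv W by auto
    then obtain a b where ab: "(a, b) \<in> parcs G" "a \<in> V" "b \<in> V" "(?p u, ?p v) = iso_arcs i (a, b)"
      by auto
    then have "?p u = ?p a" "?p v = ?p b" using ar[of "(a, b)"] by auto
    then have "u = a" "v = b" using inj uv ab by (auto dest: inj_onD)
    then show "(u, v) \<in> parcs G" using ab by simp
  qed
  then show ?R using inj W by (auto simp: bij_betw_def)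
next
  assume ?R
  then obtain p where p: "bij_betw p V W"
    and adj: "\<And>u v. u \<in> V \<Longrightarrow> v \<in> V \<Longrightarrow> (u, v) \<in> parcs G \<longleftrightarrow> (p u, p v) \<in> parcs H"
    by auto
  let ?i = "\<lparr>iso_verts = p, iso_arcs = map_prod p p, iso_head = snd, iso_tail = fst\<rparr>"
  have inj: "inj_on p V" and im: "p ` V = W" using p by (auto simp: bij_betw_def)
  have "pre_digraph.digraph_isomorphism (with_proj G \<restriction> V) ?i"
    unfolding pre_digraph.digraph_isomorphism_def
    using G inj by (auto simp: inj_on_def wf_digraph.wellformed_induce_subgraph)
  moreover have "map_prod p p ` {e \<in> parcs G. fst e \<in> V \<and> snd e \<in> V} =
      {e \<in> parcs H. fst e \<in> W \<and> snd e \<in> W}"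
  proof (intro equalityI subsetI)
    fix e assume "e \<in> map_prod p p ` {e \<in> parcs G. fst e \<in> V \<and> snd e \<in> V}"
    then show "e \<in> {e \<in> parcs H. fst e \<in> W \<and> snd e \<in> W}" using adj im by auto
  next
    fix e assume e: "e \<in> {e \<in> parcs H. fst e \<in> W \<and> snd e \<in> W}"
    then obtain u v where "u \<in> V" "v \<in> V" "e = (p u, p v)"
      using im by (metis (mono_tags, lifting) image_iff mem_Collect_eq prod.collapse)
    then show "e \<in> map_prod p p ` {e \<in> parcs G. fst e \<in> V \<and> snd e \<in> V}"
      using adj e by (intro image_eqI[where x = "(u, v)"]) auto
  qed
  then have "with_proj H \<restriction> W = app_iso ?i (with_proj G \<restriction> V)"
    using im by (intro pre_digraph.equality) auto
  ultimately show ?L by (auto simp: digraph_iso_def)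
qed

end

theory Submission
  imports Defs
begin

text \<open>
  The identity \<open>\<langle>f\<rangle> + \<langle>g\<rangle> = \<langle>f\<^sup>2 + g\<^sup>2\<rangle>\<close> shows that \<open>f\<close> and \<open>g\<close> are comaximal up to a \<open>\<mu>\<close>-unit iff
  \<open>Z(f) \<inter> Z(g)\<close> is null, whereas they annihilate each other iff \<open>(X - Z(f)) \<inter> (X - Z(g))\<close> is null.
  Sending \<open>f\<close> to the representative of the characteristic function of \<open>Z(f)\<close> exchanges, up to null
  sets, zero sets with their complements. It is an involution of \<open>V\<close>, hence an isomorphism.
\<close>

text \<open>Each of the two intersections lies in the union of the other one with the two null
  symmetric differences.\<close>

lemma emeasure_Int_sym_diff_eq_0:
  assumes "A \<in> sets M" "A' \<in> sets M" "B \<in> sets M" "B' \<in> sets M"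
    and "emeasure M (sym_diff A A') = 0" "emeasure M (sym_diff B B') = 0"
  shows "emeasure M (A \<inter> B) = 0 \<longleftrightarrow> emeasure M (A' \<inter> B') = 0"
proof -
  have n: "sym_diff A A' \<in> null_sets M" "sym_diff B B' \<in> null_sets M"
    using assms by (auto intro: null_setsI)
  have "A' \<inter> B' \<in> null_sets M" if "A \<inter> B \<in> null_sets M"
    by (rule null_sets_subset[OF null_sets.Un[OF that null_sets.Un[OF n]]]) (use assms in auto)
  moreover have "A \<inter> B \<in> null_sets M" if "A' \<inter> B' \<in> null_sets M"
    by (rule null_sets_subset[OF null_sets.Un[OF that null_sets.Un[OF n]]]) (use assms in auto)
  ultimately show ?thesis
    using assms(1-4) by (auto simp: null_sets_def)
qed

lemma zero_set_char_fun:
  "A \<in> sets M \<Longrightarrow> zero_set M (char_fun M A) = space M - A"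
  by (auto simp: zero_set_def char_fun_def indicator_def)

lemma char_fun_in_carrier:
  "A \<in> sets M \<Longrightarrow> char_fun M A \<in> carrier (meas_ring M)"
  by (simp add: meas_ring_def char_fun_def borel_measurable_restrict_space)

text \<open>The characteristic function of \<open>Z(f)\<close> vanishes exactly off
  \<open>Z(f)\<close>, so the two positivity conditions in \<open>mu_divisors\<close> trade
  places.\<close>

lemma char_fun_zero_set_in_mu_divisors:
  assumes "f \<in> mu_divisors M"
  shows "char_fun M (zero_set M f) \<in> mu_divisors M"
proof -
  have Z: "zero_set M f \<in> sets M"
    using assms by (auto simp: mu_divisors_def intro: zero_set_sets)
  then have "space M - (space M - zero_set M f) = zero_set M f"
    by (auto dest: sets.sets_into_space)
  with assms Z show ?thesis
    by (simp add: mu_divisors_def char_fun_in_carrier zero_set_char_fun)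
qed

text \<open>Pointwise quotients of measurable functions are measurable, so every
  \<open>a f + b g\<close> is a multiple of \<open>f^2 + g^2\<close>. Conversely,
  \<open>c (f^2 + g^2) = (c f) f + (c g) g\<close>.\<close>

lemma set_add_PIdl_meas_ring:
  assumes f: "f \<in> carrier (meas_ring M)" and g: "g \<in> carrier (meas_ring M)"
  shows "(PIdl\<^bsub>meas_ring M\<^esub> f) <+>\<^bsub>meas_ring M\<^esub> (PIdl\<^bsub>meas_ring M\<^esub> g)
    = PIdl\<^bsub>meas_ring M\<^esub> (\<lambda>x\<in>space M. (f x)\<^sup>2 + (g x)\<^sup>2)"
    (is "?S = PIdl\<^bsub>_\<^esub> ?u")
proof
  have [measurable]: "f \<in> borel_measurable M" "g \<in> borel_measurable M"
    using f g by (auto simp: meas_ring_def)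
  show "?S \<subseteq> PIdl\<^bsub>meas_ring M\<^esub> ?u"
  proof
    fix h assume "h \<in> ?S"
    then obtain a b where a: "a \<in> carrier (meas_ring M)" and b: "b \<in> carrier (meas_ring M)"
      and h: "h = (a \<otimes>\<^bsub>meas_ring M\<^esub> f) \<oplus>\<^bsub>meas_ring M\<^esub> (b \<otimes>\<^bsub>meas_ring M\<^esub> g)"
      by (auto simp: set_add_def' cgenideal_def)
    have [measurable]: "a \<in> borel_measurable M" "b \<in> borel_measurable M"
      using a b by (auto simp: meas_ring_def)
    \<comment> \<open>Where the denominator vanishes, so do \<open>f\<close> and \<open>g\<close>, and division yields \<open>0\<close>.\<close>
    let ?q = "\<lambda>x\<in>space M. (a x * f x + b x * g x) / ((f x)\<^sup>2 + (g x)\<^sup>2)"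
    have "?q \<in> carrier (meas_ring M)"
      by (simp add: meas_ring_def borel_measurable_restrict_space)
    moreover have "h = ?q \<otimes>\<^bsub>meas_ring M\<^esub> ?u"
      by (auto simp: h meas_ring_def fun_eq_iff sum_power2_eq_zero_iff)
    ultimately show "h \<in> PIdl\<^bsub>meas_ring M\<^esub> ?u"
      by (auto simp: cgenideal_def)
  qed
  show "PIdl\<^bsub>meas_ring M\<^esub> ?u \<subseteq> ?S"
  proof
    fix h assume "h \<in> PIdl\<^bsub>meas_ring M\<^esub> ?u"
    then obtain c where c: "c \<in> carrier (meas_ring M)" and h: "h = c \<otimes>\<^bsub>meas_ring M\<^esub> ?u"
      by (auto simp: cgenideal_def)
    interpret cring "meas_ring M" by (rule cring_meas_ring)
    have "h = ((c \<otimes>\<^bsub>meas_ring M\<^esub> f) \<otimes>\<^bsub>meas_ring M\<^esub> f) \<oplus>\<^bsub>meas_ring M\<^esub>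
        ((c \<otimes>\<^bsub>meas_ring M\<^esub> g) \<otimes>\<^bsub>meas_ring M\<^esub> g)"
      by (auto simp: h meas_ring_def fun_eq_iff power2_eq_square algebra_simps)
    moreover have "c \<otimes>\<^bsub>meas_ring M\<^esub> f \<in> carrier (meas_ring M)"
      "c \<otimes>\<^bsub>meas_ring M\<^esub> g \<in> carrier (meas_ring M)"
      using c f g by auto
    ultimately show "h \<in> ?S"
      by (auto simp: set_add_def' cgenideal_def)
  qed
qed

lemma comaximal_iff_null_zero_sets:
  assumes f: "f \<in> carrier (meas_ring M)" and g: "g \<in> carrier (meas_ring M)"
  shows "(\<exists>u. mu_unit M u \<and>
      (PIdl\<^bsub>meas_ring M\<^esub> f) <+>\<^bsub>meas_ring M\<^esub> (PIdl\<^bsub>meas_ring M\<^esub> g) = PIdl\<^bsub>meas_ring M\<^esub> u)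
    \<longleftrightarrow> emeasure M (zero_set M f \<inter> zero_set M g) = 0" (is "?L \<longleftrightarrow> ?R")
proof
  interpret cring "meas_ring M" by (rule cring_meas_ring)
  let ?v = "\<lambda>x\<in>space M. (f x)\<^sup>2 + (g x)\<^sup>2"
  have [measurable]: "f \<in> borel_measurable M" "g \<in> borel_measurable M"
    using f g by (auto simp: meas_ring_def)
  have Zv: "zero_set M ?v = zero_set M f \<inter> zero_set M g"
    by (auto simp: zero_set_def sum_power2_eq_zero_iff)
  {
    assume ?L
    then obtain u where u: "mu_unit M u" and eq: "PIdl\<^bsub>meas_ring M\<^esub> ?v = PIdl\<^bsub>meas_ring M\<^esub> u"
      using set_add_PIdl_meas_ring[OF f g] by metis
    have uc: "u \<in> carrier (meas_ring M)" using u by (simp add: mu_unit_def)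
    \<comment> \<open>Since \<open>?v\<close> divides \<open>u\<close>, \<open>u\<close> vanishes
      wherever \<open>f\<close> and \<open>g\<close> both do, and \<open>Z(u)\<close> is
      null.\<close>
    then have "u \<in> PIdl\<^bsub>meas_ring M\<^esub> ?v" using eq cgenideal_self by simp
    then obtain c where "u = c \<otimes>\<^bsub>meas_ring M\<^esub> ?v"
      by (auto simp: cgenideal_def)
    then have "zero_set M ?v \<subseteq> zero_set M u"
      by (auto simp: zero_set_def meas_ring_def)
    then show ?R
      using u zero_set_sets[OF uc] Zv by (metis emeasure_eq_0 mu_unit_def)
  next
    assume ?R
    then have "mu_unit M ?v"
      by (simp add: mu_unit_def Zv) (simp add: meas_ring_def borel_measurable_restrict_space)
    then show ?L using set_add_PIdl_meas_ring[OF f g] by blast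
  }
qed

lemma class_representatives_ex:
  assumes "class_representatives D r V" "equiv D r" "x \<in> D"
  shows "\<exists>v\<in>V. (x, v) \<in> r"
  using assms unfolding class_representatives_def by (metis Image_singleton_iff IntE quotientI)

text \<open>This turns equivalence of two elements of \<open>V\<close> into equality, which makes
  the map \<open>p\<close> below an exact involution.\<close>

lemma class_representatives_unique:
  assumes V: "class_representatives D r V" and r: "equiv D r"
    and v: "v \<in> V" "w \<in> V" "(v, w) \<in> r"
  shows "v = w"
proof -
  have "v \<in> D" using V v by (auto simp: class_representatives_def)
  then have "\<exists>!x. x \<in> V \<inter> r `` {v}"
    using V by (metis class_representatives_def quotientI)
  moreover have "v \<in> V \<inter> r `` {v}" "w \<in> V \<inter> r `` {v}"
    using v equiv_class_self[OF r \<open>v \<in> D\<close>] by auto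
  ultimately show ?thesis by blast
qed

theorem theorem3p33:
  fixes M :: "'a measure" and V :: "('a \<Rightarrow> real) set"
  assumes "emeasure M (space M) > 0"
    and "\<not> atom M (space M)"
    and "class_representatives (mu_divisors M) (zero_set_rel M) V"
    and "\<And>f. f \<in> V \<Longrightarrow>
      \<exists>A\<in>sets M. emeasure M A > 0 \<and> emeasure M (space M - A) > 0 \<and> f = char_fun M A"
  shows "digraph_iso (with_proj (zero_divisor_graph M) \<restriction> V) (with_proj (comaximal_graph M) \<restriction> V)"
proof -
  note V = assms(3)
  let ?Z = "zero_set M" and ?D = "mu_divisors M" and ?r = "zero_set_rel M"
  have VD: "V \<subseteq> ?D" using V by (simp add: class_representatives_def)
  have Dc: "f \<in> carrier (meas_ring M)" if "f \<in> ?D" for f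
    using that by (simp add: mu_divisors_def)
  have ZS: "?Z f \<in> sets M" if "f \<in> V" for f
    using that VD Dc by (blast intro: zero_set_sets)
  \<comment> \<open>The characteristic function of \<open>Z(f)\<close> may lie outside
    \<open>V\<close>; \<open>p f\<close> is the element of \<open>V\<close> in its class.\<close>
  have "\<forall>f\<in>V. \<exists>g\<in>V. (char_fun M (?Z f), g) \<in> ?r"
    using class_representatives_ex[OF V equiv_zero_set_rel] char_fun_zero_set_in_mu_divisors VD
    by blast
  then obtain p where pV: "\<And>f. f \<in> V \<Longrightarrow> p f \<in> V"
    and p: "\<And>f. f \<in> V \<Longrightarrow> (char_fun M (?Z f), p f) \<in> ?r"
    by metis
  have d: "emeasure M (sym_diff (space M - ?Z f) (?Z (p f))) = 0" if "f \<in> V" for f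
    using p[OF that] ZS[OF that] by (simp add: zero_set_rel_def zero_set_char_fun)
  have pp: "p (p f) = f" if f: "f \<in> V" for f
  proof -
    \<comment> \<open>Complementing both sets leaves a symmetric difference unchanged. Hence
      \<open>f\<close> is equivalent to the characteristic function of \<open>Z(p f)\<close>, whose
      representative is \<open>p (p f)\<close>.\<close>
    have "sym_diff (space M - ?Z f) (?Z (p f)) = sym_diff (?Z f) (space M - ?Z (p f))"
      using ZS[OF f] ZS[OF pV[OF f]] by (auto dest: sets.sets_into_space)
    then have "(f, char_fun M (?Z (p f))) \<in> ?r"
      using d[OF f] f VD ZS[OF pV[OF f]] char_fun_zero_set_in_mu_divisors[of "p f" M] pV[OF f]
      by (auto simp: zero_set_rel_def zero_set_char_fun)
    then have "(f, p (p f)) \<in> ?r"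
      using p[OF pV[OF f]] equiv_zero_set_rel by (meson equivE transD)
    then show ?thesis
      using class_representatives_unique[OF V equiv_zero_set_rel] f pV by metis
  qed
  have bij: "bij_betw p V V"
    by (rule bij_betw_byWitness[where f' = p]) (use pp pV in auto)
  have "(f, g) \<in> parcs (zero_divisor_graph M) \<longleftrightarrow> (p f, p g) \<in> parcs (comaximal_graph M)"
    if f: "f \<in> V" and g: "g \<in> V" for f g
  proof -
    \<comment> \<open>By \<open>d\<close>, each complement may be replaced by the zero set of the
      image under \<open>p\<close>, turning annihilation into comaximality.\<close>
    have "emeasure M ((space M - ?Z f) \<inter> (space M - ?Z g)) = 0
        \<longleftrightarrow> emeasure M (?Z (p f) \<inter> ?Z (p g)) = 0"
      using f g by (intro emeasure_Int_sym_diff_eq_0 d) (auto intro: ZS pV)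
    \<comment> \<open>Adjacency also demands distinct vertices, a condition that the involution
      \<open>p\<close> preserves and reflects.\<close>
    moreover have "f = g \<longleftrightarrow> p f = p g" using pp f g by metis
    moreover have "f \<in> ?D" "g \<in> ?D" "p f \<in> ?D" "p g \<in> ?D"
      using f g pV VD by auto
    ultimately show ?thesis
      by (simp add: zero_divisor_graph_def comaximal_graph_def comaximal_iff_null_zero_sets Dc)
  qed
  moreover have "wf_digraph (with_proj (zero_divisor_graph M))"
    using simple_zero_divisor_graph(1) by (rule loopfree_digraph.axioms(1))
  ultimately show ?thesis
    using bij by (subst digraph_iso_induced_iff) auto
qed

end
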